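(* In the setting described in the context, let $\{(x_k,z_k)\}$ and $\{(y_k,c_k)\}$ be the sequences generated by DSG-2. Suppose that the parameter sequence satisfies $\alpha_k\ge\bar\alpha>0$ for all $k$, and that $\sigma$ is either coercive or conditionally coercive. Then only one of the following cases occurs: (a) There exists $\bar k$ such that DSG-2 stops at iteration $\bar k$. As a consequence, $x_{\bar k}$ is an $\epsilon$-optimal primal solution and $(y_{\bar k},c_{\bar k})$ is an $\epsilon$-optimal dual solution. In this situation $\{(y_k,c_k)\}$ must be bounded. (b) The dual sequence $\{(y_k,c_k)\}$ is unbounded. In this case, $\{z_k\}$ converges weakly to $0$, $\{q_k\}$ with $q_k:=q(y_k,c_k)$ converges to $M_P$, the primal sequence $\{x_k\}$ is bounded and all its weak accumulation points are primal solutions (minimizers of $\varphi$ on $X$).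
   Context: Setting. $X$ is a reflexive Banach space, $H$ a Hilbert space, $\mathbb{R}_+=[0,\infty)$. A set is weakly compact if its weak closure is compact in the weak topology. An extended-real function is w-lsc (weakly lower semicontinuous) if its epigraph is weakly closed, and w-usc if its negative is w-lsc. $\varphi:X\to\mathbb{R}\cup\{+\infty\}$ is proper, w-lsc, and its level sets $\{\varphi\le\alpha\}$ are weakly compact. $M_P=\inf_X\varphi$. $f:X\times H\to[-\infty,+\infty]$ satisfies $f(x,0)=\varphi(x)$ for all $x$, is proper ($\mathrm{dom}\,f\neq\emptyset$, $f>-\infty$), w-lsc and weakly level-compact: for each $\bar z\in H$, $\alpha\in\mathbb{R}$ there are a weakly open neighbourhood $U$ of $\bar z$ and a weakly compact $B\subset X$ with $\{x:f(x,z)\le\alpha\}\subset B$ for all $z\in U$. $\sigma:H\to\mathbb{R}\cup\{+\infty\}$ is proper, w-lsc, $\sigma(0)=0$, $\mathrm{argmin}\,\sigma=\{0\}$; it is coercive if $\sigma(z)\to+\infty$ as $\|z\|\to\infty$, and conditionally coercive if $\{\sigma\le K_\sigma\}$ is bounded for some $K_\sigma>0$. $A:H\to H$ satisfies $\|A(z)\|\le\sigma(z)$ for all $z$, and $z\mapsto\langle A(z),y\rangle$ is w-usc for every $y\in H$. The dual function is $q(y,c)=\inf_{(x,z)\in X\times H}\{f(x,z)-\langle A(z),y\rangle+c\sigma(z)\}$ on $H\times\mathbb{R}_+$, with the convention $0\cdot(+\infty)=+\infty$ in $c\sigma(z)$; $M_D=\sup_{H\times\mathbb{R}_+}q$. It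 is assumed that $q(\bar y,\bar c)>-\infty$ for some $(\bar y,\bar c)\in H\times\mathbb{R}_+$; under these assumptions $M_P=M_D$. A point $x_*\in X$ is an $\epsilon$-optimal primal solution if $\varphi(x_* )\le M_P+\epsilon$, and $(y_*,c_* )\in H\times\mathbb{R}_+$ is an $\epsilon$-optimal dual solution if $q(y_*,c_* )\ge M_D-\epsilon$. For $r\ge0$, $X_r(y,c)=\{(x,z)\in X\times H: f(x,z)-\langle A(z),y\rangle+c\sigma(z)\le q(y,c)+r\}$. Algorithm DSG. Step 0: choose $(y_0,c_0)\in H\times\mathbb{R}_+$ with $q(y_0,c_0)>-\infty$, a tolerance $\epsilon>0$, $0\le\delta<1$, $\{\alpha_k\}\subset(0,\alpha)$ for some $\alpha>0$, and $\{r_k\}\subset\mathbb{R}_+$ with $r_k\to0$; $k:=0$. Step 1: (a) find $(x_k,z_k)\in X_{r_k}(y_k,c_k)$; (b) if $z_k=0$ and $r_k\le\epsilon$, stop; (c) if $z_k=0$ and $r_k>\epsilon$, replace $r_k$ by $\delta r_k$ and go to (a); (d) if $z_k\ne0$ go to Step 2. Step 2: take a stepsize $s_k>0$, set $y_{k+1}=y_k-s_kA(z_k)$, $c_{k+1}=c_k+(\alpha_k+1)s_k\sigma(z_k)$, $k:=k+1$, go to Step 1. ($r_k,x_k,z_k$ denote the final values at iteration $k$; the elements required in Step 1(a) are assumed to exist.) DSG-2 is DSG with stepsizes $s_k\in[\theta_k/\sigma(z_k),\,\beta/\sigma(z_k)]$, where $\beta>0$ and $\{\theta_k\}\subset\mathbb{R}_+$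 satisfies $\sum_j\theta_j=\infty$ and $\theta_k\le\beta$ for all $k$. *)

theory Defs
  imports "HOL-Analysis.Analysis"
begin

definition reflexive_space :: "'a::real_normed_vector itself \<Rightarrow> bool" where
  "reflexive_space _ \<longleftrightarrow>
     (\<forall>F :: ('a \<Rightarrow>\<^sub>L real) \<Rightarrow>\<^sub>L real. \<exists>x::'a. \<forall>g. blinfun_apply F g = blinfun_apply g x)"

definition weak_topology :: "'a::real_normed_vector topology" where
  "weak_topology = topology_generated_by
     {blinfun_apply g -` V | (g :: 'a \<Rightarrow>\<^sub>L real) V. open V}"

text \<open>Weak compactness is understood as relative weak compactness: the weak closure is compact.\<close>

definition weakly_compact :: "'a::real_normed_vector set \<Rightarrow> bool" where
  "weakly_compact S \<longleftrightarrow> compactin weak_topology (weak_topology closure_of S)"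

text \<open>The epigraph is a subset of the normed space \<open>'a \<times> real\<close> and is closed in the weak
  topology of that product.\<close>

definition w_lsc :: "('a::real_normed_vector \<Rightarrow> ereal) \<Rightarrow> bool" where
  "w_lsc g \<longleftrightarrow> closedin weak_topology {(x, t::real). g x \<le> ereal t}"

definition w_usc :: "('a::real_normed_vector \<Rightarrow> ereal) \<Rightarrow> bool" where
  "w_usc g \<longleftrightarrow> w_lsc (\<lambda>x. - g x)"

definition proper_fun :: "('a \<Rightarrow> ereal) \<Rightarrow> bool" where
  "proper_fun g \<longleftrightarrow> (\<forall>x. g x > -\<infinity>) \<and> (\<exists>x. g x < \<infinity>)"

definition weakly_level_compact ::
    "('a::real_normed_vector \<times> 'h::real_normed_vector \<Rightarrow> ereal) \<Rightarrow> bool" where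
  "weakly_level_compact f \<longleftrightarrow>
     (\<forall>zbar. \<forall>a::real. \<exists>U B. openin weak_topology U \<and> zbar \<in> U \<and> weakly_compact B \<and>
        (\<forall>z\<in>U. {x. f (x, z) \<le> ereal a} \<subseteq> B))"

definition argmin_set :: "('a \<Rightarrow> ereal) \<Rightarrow> 'a set" where
  "argmin_set g = {x. \<forall>w. g x \<le> g w}"

definition coercive :: "('a::real_normed_vector \<Rightarrow> ereal) \<Rightarrow> bool" where
  "coercive g \<longleftrightarrow> (g \<longlongrightarrow> \<infinity>) at_infinity"

definition conditionally_coercive :: "('a::real_normed_vector \<Rightarrow> ereal) \<Rightarrow> bool" where
  "conditionally_coercive g \<longleftrightarrow> (\<exists>K>0::real. bounded {z. g z \<le> ereal K})"

text \<open>Multiplication of an extended real by \<open>c \<ge> 0\<close> with the convention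
  \<open>0 * \<infinity> = \<infinity>\<close>, whereas \<open>0 * \<infinity> = 0\<close> in the type of extended reals.\<close>

definition scale_ereal :: "real \<Rightarrow> ereal \<Rightarrow> ereal" where
  "scale_ereal c s = (if s = \<infinity> then \<infinity> else ereal c * s)"

definition lagrangian ::
    "('a \<times> 'h \<Rightarrow> ereal) \<Rightarrow> ('h \<Rightarrow> 'h::real_inner) \<Rightarrow> ('h \<Rightarrow> ereal) \<Rightarrow> 'h \<Rightarrow> real \<Rightarrow> 'a \<times> 'h \<Rightarrow> ereal" where
  "lagrangian f A \<sigma> y c = (\<lambda>(x, z). f (x, z) - ereal (A z \<bullet> y) + scale_ereal c (\<sigma> z))"

definition dual_fun ::
    "('a \<times> 'h \<Rightarrow> ereal) \<Rightarrow> ('h \<Rightarrow> 'h::real_inner) \<Rightarrow> ('h \<Rightarrow> ereal) \<Rightarrow> 'h \<Rightarrow> real \<Rightarrow> ereal" where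
  "dual_fun f A \<sigma> y c = (INF p. lagrangian f A \<sigma> y c p)"

definition primal_value :: "('a \<Rightarrow> ereal) \<Rightarrow> ereal" where
  "primal_value \<phi> = (INF x. \<phi> x)"

definition dual_value ::
    "('a \<times> 'h \<Rightarrow> ereal) \<Rightarrow> ('h \<Rightarrow> 'h::real_inner) \<Rightarrow> ('h \<Rightarrow> ereal) \<Rightarrow> ereal" where
  "dual_value f A \<sigma> = (SUP (y, c) \<in> UNIV \<times> {0..}. dual_fun f A \<sigma> y c)"

definition eps_optimal_primal :: "('a \<Rightarrow> ereal) \<Rightarrow> real \<Rightarrow> 'a \<Rightarrow> bool" where
  "eps_optimal_primal \<phi> \<epsilon> x \<longleftrightarrow> \<phi> x \<le> primal_value \<phi> + ereal \<epsilon>"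

definition eps_optimal_dual ::
    "('a \<times> 'h \<Rightarrow> ereal) \<Rightarrow> ('h \<Rightarrow> 'h::real_inner) \<Rightarrow> ('h \<Rightarrow> ereal) \<Rightarrow> real \<Rightarrow> 'h \<Rightarrow> real \<Rightarrow> bool" where
  "eps_optimal_dual f A \<sigma> \<epsilon> y c \<longleftrightarrow>
     0 \<le> c \<and> dual_fun f A \<sigma> y c \<ge> dual_value f A \<sigma> - ereal \<epsilon>"

definition approx_minimizers ::
    "('a \<times> 'h \<Rightarrow> ereal) \<Rightarrow> ('h \<Rightarrow> 'h::real_inner) \<Rightarrow> ('h \<Rightarrow> ereal) \<Rightarrow> real \<Rightarrow> 'h \<Rightarrow> real \<Rightarrow> ('a \<times> 'h) set" where
  "approx_minimizers f A \<sigma> r y c =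
     {p. lagrangian f A \<sigma> y c p \<le> dual_fun f A \<sigma> y c + ereal r}"

text \<open>\<open>dsg_step1 f A \<sigma> \<epsilon> \<delta> y c \<rho> r x z\<close>: started with tolerance \<open>\<rho>\<close> at the dual point
  \<open>(y, c)\<close>, the inner loop (Step 1) can be left with the final values \<open>r\<close>, \<open>x\<close>, \<open>z\<close>, after
  finitely many replacements of the current tolerance by \<open>\<delta>\<close> times itself.\<close>

inductive dsg_step1 ::
    "('a \<times> 'h \<Rightarrow> ereal) \<Rightarrow> ('h \<Rightarrow> 'h::real_inner) \<Rightarrow> ('h \<Rightarrow> ereal) \<Rightarrow> real \<Rightarrow> real \<Rightarrow> 'h \<Rightarrow> real \<Rightarrow>
     real \<Rightarrow> real \<Rightarrow> 'a \<Rightarrow> 'h \<Rightarrow> bool"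
  for f A \<sigma> \<epsilon> \<delta> y c where
  leave: "(x, z) \<in> approx_minimizers f A \<sigma> r y c \<Longrightarrow> z \<noteq> 0 \<or> r \<le> \<epsilon> \<Longrightarrow>
    dsg_step1 f A \<sigma> \<epsilon> \<delta> y c r r x z"
| retry: "(x', 0) \<in> approx_minimizers f A \<sigma> \<rho> y c \<Longrightarrow> \<rho> > \<epsilon> \<Longrightarrow>
    dsg_step1 f A \<sigma> \<epsilon> \<delta> y c (\<delta> * \<rho>) r x z \<Longrightarrow>
    dsg_step1 f A \<sigma> \<epsilon> \<delta> y c \<rho> r x z"

text \<open>A run of DSG. \<open>T\<close> is the iteration at which the algorithm stops, \<open>T = \<infinity>\<close> if it never
  stops; only the values of the iterates at indices \<open>k \<le> T\<close> (of the stepsizes, \<open>k < T\<close>) are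
  meaningful. \<open>\<rho>\<close> is the tolerance sequence chosen in Step 0 and \<open>r\<close> the sequence of final
  tolerances. Inside \<open>dsg_step1\<close>, \<open>z k = 0\<close> is only possible if \<open>r k \<le> \<epsilon>\<close>, so the algorithm
  stops precisely when \<open>z k = 0\<close>. The update of \<open>c\<close> is written in the extended reals, where
  it entails that \<open>\<sigma> (z k)\<close> is finite.\<close>

definition DSG_run ::
    "('a \<times> 'h \<Rightarrow> ereal) \<Rightarrow> ('h \<Rightarrow> 'h::real_inner) \<Rightarrow> ('h \<Rightarrow> ereal) \<Rightarrow>
     real \<Rightarrow> real \<Rightarrow> (nat \<Rightarrow> real) \<Rightarrow> (nat \<Rightarrow> real) \<Rightarrow>
     enat \<Rightarrow> (nat \<Rightarrow> real) \<Rightarrow> (nat \<Rightarrow> 'a) \<Rightarrow> (nat \<Rightarrow> 'h) \<Rightarrow> (nat \<Rightarrow> real) \<Rightarrow>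
     (nat \<Rightarrow> 'h) \<Rightarrow> (nat \<Rightarrow> real) \<Rightarrow> bool" where
  "DSG_run f A \<sigma> \<epsilon> \<delta> \<alpha> \<rho> T r x z s y c \<longleftrightarrow>
     0 \<le> c 0 \<and> dual_fun f A \<sigma> (y 0) (c 0) > -\<infinity> \<and>
     0 < \<epsilon> \<and> 0 \<le> \<delta> \<and> \<delta> < 1 \<and>
     (\<exists>a>0. \<forall>k. 0 < \<alpha> k \<and> \<alpha> k < a) \<and>
     (\<forall>k. 0 \<le> \<rho> k) \<and> \<rho> \<longlonglongrightarrow> 0 \<and>
     (\<forall>k. enat k \<le> T \<longrightarrow>
        dsg_step1 f A \<sigma> \<epsilon> \<delta> (y k) (c k) (\<rho> k) (r k) (x k) (z k) \<and>
        (T = enat k \<longleftrightarrow> z k = 0)) \<and>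
     (\<forall>k. enat k < T \<longrightarrow>
        0 < s k \<and>
        y (Suc k) = y k - s k *\<^sub>R A (z k) \<and>
        ereal (c (Suc k)) = ereal (c k) + ereal ((\<alpha> k + 1) * s k) * \<sigma> (z k))"

definition DSG2_run ::
    "('a \<times> 'h \<Rightarrow> ereal) \<Rightarrow> ('h \<Rightarrow> 'h::real_inner) \<Rightarrow> ('h \<Rightarrow> ereal) \<Rightarrow>
     real \<Rightarrow> real \<Rightarrow> (nat \<Rightarrow> real) \<Rightarrow> (nat \<Rightarrow> real) \<Rightarrow> (nat \<Rightarrow> real) \<Rightarrow> real \<Rightarrow>
     enat \<Rightarrow> (nat \<Rightarrow> real) \<Rightarrow> (nat \<Rightarrow> 'a) \<Rightarrow> (nat \<Rightarrow> 'h) \<Rightarrow> (nat \<Rightarrow> real) \<Rightarrow>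
     (nat \<Rightarrow> 'h) \<Rightarrow> (nat \<Rightarrow> real) \<Rightarrow> bool" where
  "DSG2_run f A \<sigma> \<epsilon> \<delta> \<alpha> \<rho> \<theta> \<beta> T r x z s y c \<longleftrightarrow>
     DSG_run f A \<sigma> \<epsilon> \<delta> \<alpha> \<rho> T r x z s y c \<and>
     0 < \<beta> \<and> (\<forall>k. 0 \<le> \<theta> k \<and> \<theta> k \<le> \<beta>) \<and>
     filterlim (\<lambda>n. \<Sum>j<n. \<theta> j) at_top sequentially \<and>
     (\<forall>k. enat k < T \<longrightarrow>
        ereal (\<theta> k) / \<sigma> (z k) \<le> ereal (s k) \<and> ereal (s k) \<le> ereal \<beta> / \<sigma> (z k))"

definition weak_accumulation_point :: "(nat \<Rightarrow> 'a::real_normed_vector) \<Rightarrow> 'a \<Rightarrow> bool" where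
  "weak_accumulation_point u p \<longleftrightarrow>
     (\<forall>U. openin weak_topology U \<and> p \<in> U \<longrightarrow> (\<exists>\<^sub>\<infinity>k. u k \<in> U))"

end

theory Submission
  imports Defs
begin

text \<open>
  The first dual value is finite, and the dual update moves \<open>c\<close> up by at least
  \<open>1 + alpha_bar\<close> times the distance that \<open>y\<close> travels. Since the stepsizes force
  \<open>c k \<longlonglongrightarrow> \<infinity>\<close> on every infinite run, comparing the Lagrangian at \<open>(y k, c k)\<close> with the one
  at \<open>(y 0, c 0)\<close> shows \<open>\<sigma> (z k) \<longlonglongrightarrow> 0\<close>. Coercivity puts \<open>z k\<close> in a ball, which is weakly compact,
  so the unique minimizer \<open>0\<close> of \<open>\<sigma>\<close> is the weak limit. Weak level-compactness of \<open>f\<close> then traps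
  \<open>x k\<close> in a relatively weakly compact set, which is norm bounded by Hahn-Banach and Baire, and weak
  lower semicontinuity of \<open>f\<close> passes the near-optimality of \<open>(x k, z k)\<close> to the limit.
\<close>

subsection \<open>Hahn-Banach and weakly bounded sets\<close>

definition sublinear :: "('a::real_vector \<Rightarrow> real) \<Rightarrow> bool" where
  "sublinear p \<longleftrightarrow> (\<forall>x y. p (x + y) \<le> p x + p y) \<and> (\<forall>t x. 0 \<le> t \<longrightarrow> p (t *\<^sub>R x) = t * p x)"

lemma sublinearD:
  assumes "sublinear p"
  shows "p (x + y) \<le> p x + p y" "0 \<le> t \<Longrightarrow> p (t *\<^sub>R x) = t * p x"
  using assms by (auto simp: sublinear_def)

lemma sublinear_zero: "sublinear p \<Longrightarrow> p 0 = 0"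
  using sublinearD(2)[of p 0 0] by simp

lemma sublinear_minus: "sublinear p \<Longrightarrow> - p (- x) \<le> p x"
  using sublinearD(1)[of p x "- x"] sublinear_zero[of p] by simp

text \<open>An inequality for positive \<open>t\<close> suffices: used again with
  \<open>inverse t\<close> at \<open>t *\<^sub>R x\<close>, it gives the reverse one.\<close>

lemma sublinearI_pos:
  assumes add: "\<And>x y. p (x + y) \<le> p x + p y" and zero: "p 0 = 0"
    and scale: "\<And>t x. 0 < t \<Longrightarrow> p (t *\<^sub>R x) \<le> t * p x"
  shows "sublinear p"
  unfolding sublinear_def
proof (intro conjI allI impI)
  fix t :: real and x assume "0 \<le> t"
  show "p (t *\<^sub>R x) = t * p x"
  proof (cases "t = 0")
    case True then show ?thesis by (simp add: zero)
  next
    case False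
    with \<open>0 \<le> t\<close> have "t > 0" by simp
    then have "p x \<le> inverse t * p (t *\<^sub>R x)"
      using scale[of "inverse t" "t *\<^sub>R x"] by simp
    with \<open>t > 0\<close> have "t * p x \<le> p (t *\<^sub>R x)"
      by (simp add: field_simps)
    with scale[OF \<open>t > 0\<close>, of x] show ?thesis by simp
  qed
qed (rule add)

text \<open>The infimum is the largest sublinear functional below \<open>p\<close> whose value at
  \<open>- x\<close> is at most \<open>- p x\<close>. It serves twice: to show that a minimal
  functional is odd, and to find a norming functional.\<close>

lemma sublinear_shift:
  fixes x :: "'a::real_vector"
  assumes p: "sublinear p"
  defines "q \<equiv> \<lambda>v. INF t\<in>{0::real..}. p (v + t *\<^sub>R x) - t * p x"
  shows "sublinear q" "q v \<le> p v" "q (- x) \<le> - p x"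
proof -
  \<comment> \<open>A real \<open>INF\<close> is meaningful only with a lower bound; writing
    \<open>t *\<^sub>R x\<close> as the sum of \<open>v + t *\<^sub>R x\<close> and
    \<open>- v\<close> provides \<open>- p (- v)\<close>.\<close>
  have bdd: "bdd_below ((\<lambda>t. p (v + t *\<^sub>R x) - t * p x) ` {0..})" for v
  proof (rule bdd_belowI2)
    fix t :: real assume "t \<in> {0..}"
    then show "- p (- v) \<le> p (v + t *\<^sub>R x) - t * p x"
      using sublinearD(1)[OF p, of "v + t *\<^sub>R x" "- v"] sublinearD(2)[OF p, of t x] by simp
  qed
  have le: "q v \<le> p (v + t *\<^sub>R x) - t * p x" if "0 \<le> t" for v t
    unfolding q_def using that by (intro cINF_lower[OF bdd]) simp
  have ge: "a \<le> q v" if "\<And>t. 0 \<le> t \<Longrightarrow> a \<le> p (v + t *\<^sub>R x) - t * p x" for a v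
    unfolding q_def using that by (intro cINF_greatest) auto
  show "q v \<le> p v" using le[of 0] by simp
  show "q (- x) \<le> - p x" using le[of 1 "- x"] by (simp add: sublinear_zero[OF p])
  show "sublinear q"
  proof (rule sublinearI_pos)
    show "q 0 = 0"
      unfolding q_def using sublinearD(2)[OF p, of _ x] by simp
    fix v w
    \<comment> \<open>The two infima are taken one at a time: \<open>t\<close> stays fixed while
      \<open>s\<close> varies, and the shift by \<open>t + s\<close> is the competitor for
      \<open>v + w\<close>.\<close>
    have "q (v + w) - (p (v + t *\<^sub>R x) - t * p x) \<le> q w" if t: "0 \<le> t" for t
    proof (rule ge)
      fix s :: real assume s: "0 \<le> s"
      have "q (v + w) \<le> p (v + w + (t + s) *\<^sub>R x) - (t + s) * p x"
        using s t by (intro le) simp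
      moreover have "p (v + w + (t + s) *\<^sub>R x) \<le> p (v + t *\<^sub>R x) + p (w + s *\<^sub>R x)"
        using sublinearD(1)[OF p, of "v + t *\<^sub>R x" "w + s *\<^sub>R x"] by (simp add: algebra_simps)
      ultimately show "q (v + w) - (p (v + t *\<^sub>R x) - t * p x) \<le> p (w + s *\<^sub>R x) - s * p x"
        by (simp add: algebra_simps)
    qed
    then have "q (v + w) - q w \<le> q v"
      by (intro ge) (smt (verit))
    then show "q (v + w) \<le> q v + q w" by simp
  next
    fix a :: real and v assume a: "0 < a"
    have "q (a *\<^sub>R v) / a \<le> q v"
    proof (rule ge)
      fix t :: real assume t: "0 \<le> t"
      have "q (a *\<^sub>R v) \<le> p (a *\<^sub>R v + (a * t) *\<^sub>R x) - a * t * p x"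
        using a t by (intro le) simp
      also have "p (a *\<^sub>R v + (a * t) *\<^sub>R x) = a * p (v + t *\<^sub>R x)"
        using sublinearD(2)[OF p, of a "v + t *\<^sub>R x"] a by (simp add: algebra_simps)
      finally show "q (a *\<^sub>R v) / a \<le> p (v + t *\<^sub>R x) - t * p x"
        using a by (simp add: field_simps)
    qed
    then show "q (a *\<^sub>R v) \<le> a * q v" using a by (simp add: field_simps)
  qed
qed

text \<open>The common bound \<open>p0\<close> keeps the infimum finite, because
  \<open>- p0 (- v) \<le> - p (- v) \<le> p v\<close>. For subadditivity, the smaller of two chain
  members lies below both, so its own subadditivity handles the pair.\<close>

lemma sublinear_INF_chain:
  assumes ne: "C \<noteq> {}" and sub: "\<And>p. p \<in> C \<Longrightarrow> sublinear p"
    and le: "\<And>p v. p \<in> C \<Longrightarrow> p v \<le> p0 v"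
    and chain: "\<And>p q. p \<in> C \<Longrightarrow> q \<in> C \<Longrightarrow> p \<le> q \<or> q \<le> p"
  shows "sublinear (\<lambda>v. INF p\<in>C. p v)" "p \<in> C \<Longrightarrow> (INF p\<in>C. p v) \<le> p v"
proof -
  have bdd: "bdd_below ((\<lambda>p. p v) ` C)" for v
  proof (rule bdd_belowI2)
    fix p assume "p \<in> C"
    then show "- p0 (- v) \<le> p v"
      using sublinear_minus[OF sub, of p v] le[of p "- v"] by linarith
  qed
  have lower: "(INF p\<in>C. p v) \<le> p v" if "p \<in> C" for p v
    using that by (intro cINF_lower[OF bdd])
  then show "p \<in> C \<Longrightarrow> (INF p\<in>C. p v) \<le> p v" .
  let ?u = "\<lambda>v. INF p\<in>C. p v"
  show "sublinear ?u"
  proof (rule sublinearI_pos)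
    show "?u 0 = 0" using ne by (simp add: sublinear_zero[OF sub])
    fix v w
    have "?u (v + w) - p v \<le> ?u w" if p: "p \<in> C" for p
    proof (rule cINF_greatest[OF ne])
      fix q assume q: "q \<in> C"
      obtain m where m: "m \<in> C" "m \<le> p" "m \<le> q"
        using chain[OF p q] p q by blast
      have "?u (v + w) \<le> m (v + w)" by (rule lower[OF m(1)])
      also have "\<dots> \<le> m v + m w" by (rule sublinearD(1)[OF sub[OF m(1)]])
      also have "\<dots> \<le> p v + q w" using m by (intro add_mono) (auto simp: le_fun_def)
      finally show "?u (v + w) - p v \<le> q w" by simp
    qed
    then have "?u (v + w) - ?u w \<le> ?u v"
      by (intro cINF_greatest[OF ne]) (smt (verit))
    then show "?u (v + w) \<le> ?u v + ?u w" by simp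
  next
    fix t :: real and v assume t: "0 < t"
    have "?u (t *\<^sub>R v) / t \<le> ?u v"
    proof (rule cINF_greatest[OF ne])
      fix p assume p: "p \<in> C"
      have "?u (t *\<^sub>R v) \<le> t * p v"
        using lower[OF p, of "t *\<^sub>R v"] sublinearD(2)[OF sub[OF p], of t v] t by simp
      then show "?u (t *\<^sub>R v) / t \<le> p v" using t by (simp add: field_simps)
    qed
    then show "?u (t *\<^sub>R v) \<le> t * ?u v" using t by (simp add: field_simps)
  qed
qed

text \<open>By Zorn's lemma there is a minimal sublinear functional below the given one; minimality
  forces it to coincide with each of its shifts, which makes it odd and hence linear.\<close>

lemma sublinear_dominates_linear:
  fixes p0 :: "'a::real_vector \<Rightarrow> real"
  assumes p0: "sublinear p0"
  obtains g where "linear g" "\<And>v. g v \<le> p0 v"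
proof -
  define A where "A = {p. sublinear p \<and> p \<le> p0}"
  have "\<exists>m\<in>A. \<forall>a\<in>A. a \<le> m \<longrightarrow> a = m"
  proof (rule predicate_Zorn)
    \<comment> \<open>The order is reversed, so that the maximal element of Zorn's lemma is a
      minimal functional.\<close>
    show "partial_order_on A (relation_of (\<lambda>p q. q \<le> p) A)"
      by (auto simp: partial_order_on_def preorder_on_def refl_on_def trans_def antisym_def
          relation_of_def)
    fix C assume C: "C \<in> Chains (relation_of (\<lambda>p q. q \<le> p) A)"
    show "\<exists>u\<in>A. \<forall>a\<in>C. u \<le> a"
    proof (cases "C = {}")
      case True
      then show ?thesis using p0 by (auto simp: A_def)
    next
      case False
      have CA: "C \<subseteq> A" and chain: "\<And>p q. p \<in> C \<Longrightarrow> q \<in> C \<Longrightarrow> p \<le> q \<or> q \<le> p"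
        using C by (auto simp: Chains_def relation_of_def)
      have sub: "sublinear p" "p v \<le> p0 v" if "p \<in> C" for p v
        using that CA by (auto simp: A_def le_fun_def)
      let ?u = "\<lambda>v. INF p\<in>C. p v"
      have inf: "sublinear ?u" "\<And>p v. p \<in> C \<Longrightarrow> ?u v \<le> p v"
        using sub chain by (intro sublinear_INF_chain[of C p0] False; blast)+
      obtain p where p: "p \<in> C" using False by blast
      have "?u \<le> p" using inf(2)[OF p] by (simp add: le_fun_def)
      then have "?u \<in> A" using inf(1) p CA by (force simp: A_def)
      then show ?thesis using inf(2) by (force simp: le_fun_def)
    qed
  qed
  then obtain m where "m \<in> A" and min_A: "\<forall>a\<in>A. a \<le> m \<longrightarrow> a = m" by blast
  then have m: "sublinear m" "m \<le> p0" by (auto simp: A_def)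
  have min: "q = m" if "sublinear q" "q \<le> m" for q
    using that min_A order.trans[OF that(2) m(2)] unfolding A_def by blast
  have odd: "m (- x) = - m x" for x
  proof -
    note shift = sublinear_shift[OF m(1), where x = x]
    have "(\<lambda>v. INF t\<in>{0::real..}. m (v + t *\<^sub>R x) - t * m x) = m"
      by (intro min shift(1) le_funI shift(2))
    from fun_cong[OF this, of "- x"] shift(3) have "m (- x) \<le> - m x" by simp
    with sublinear_minus[OF m(1), of x] show ?thesis by simp
  qed
  have "linear m"
  proof (rule linearI)
    fix x y
    have "m x \<le> m (x + y) + m (- y)" using sublinearD(1)[OF m(1), of "x + y" "- y"] by simp
    then show "m (x + y) = m x + m y"
      using sublinearD(1)[OF m(1), of x y] odd[of y] by simp
  next
    fix t :: real and x
    show "m (t *\<^sub>R x) = t *\<^sub>R m x"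
    proof (cases "0 \<le> t")
      case True then show ?thesis using sublinearD(2)[OF m(1)] by simp
    next
      case False
      then show ?thesis
        using sublinearD(2)[OF m(1), of "- t" x] odd[of "t *\<^sub>R x"] by simp
    qed
  qed
  with m(2) show thesis by (intro that) (auto simp: le_fun_def)
qed

section \<open>Norming functionals and uniform boundedness\<close>

text \<open>The dominating functional is the shift of the norm along \<open>x\<close> instead of the
  norm itself: this forces \<open>g (- x) \<le> - norm x\<close> while \<open>g\<close> stays below
  the norm.\<close>

lemma norming_functional:
  fixes x :: "'a::real_normed_vector"
  obtains g :: "'a \<Rightarrow>\<^sub>L real" where "norm g \<le> 1" "norm x \<le> blinfun_apply g x"
proof -
  have norm: "sublinear (norm :: 'a \<Rightarrow> real)"
    by (auto simp: sublinear_def norm_triangle_ineq)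
  note shift = sublinear_shift[OF norm, where x = x]
  obtain g where g: "linear g"
    and le: "\<And>v. g v \<le> (INF t\<in>{0::real..}. norm (v + t *\<^sub>R x) - t * norm x)"
    using sublinear_dominates_linear[OF shift(1)] by blast
  have g_le: "g v \<le> norm v" for v using le[of v] shift(2)[of v] by linarith
  have abs: "\<bar>g v\<bar> \<le> norm v" for v
    using g_le[of v] g_le[of "- v"] linear_neg[OF g, of v] by simp
  have "bounded_linear g"
    using abs linear_add[OF g] linear_scale[OF g] by (intro bounded_linear_intro[where K=1]) auto
  then have app: "blinfun_apply (Blinfun g) = g" by (rule bounded_linear_Blinfun_apply)
  show thesis
  proof
    show "norm (Blinfun g) \<le> 1"
      using abs by (intro norm_blinfun_bound) (auto simp: app)
    show "norm x \<le> blinfun_apply (Blinfun g) x"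
      using le[of "- x"] shift(3) linear_neg[OF g, of x] by (simp add: app)
  qed
qed

text \<open>Uniform boundedness principle: Baire's theorem is applied in the dual space, which is
  complete for every normed space, and norming functionals turn a bound over the dual unit ball into
  a norm bound.\<close>

lemma weakly_bounded_imp_bounded:
  fixes B :: "'a::real_normed_vector set"
  assumes wb: "\<And>g :: 'a \<Rightarrow>\<^sub>L real. bounded (blinfun_apply g ` B)"
  shows "bounded B"
proof -
  define E where "E n = {g :: 'a \<Rightarrow>\<^sub>L real. \<forall>x\<in>B. \<bar>blinfun_apply g x\<bar> \<le> real n}" for n
  have E_alt: "E n = (\<Inter>x\<in>B. {g. \<bar>blinfun_apply g x\<bar> \<le> real n})" for n
    by (auto simp: E_def)
  have cl: "closed (E n)" for n
    unfolding E_alt by (intro closed_INT ballI closed_Collect_le continuous_intros)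
  have cover: "\<Union>(range E) = UNIV"
  proof -
    have "\<exists>n. g \<in> E n" for g
    proof -
      obtain M where M: "\<forall>x\<in>B. \<bar>blinfun_apply g x\<bar> \<le> M" using wb[of g] by (auto simp: bounded_iff)
      obtain n where "M \<le> real n" using real_arch_simple by blast
      with M show ?thesis by (auto simp: E_def intro!: exI[of _ n])
    qed
    then show ?thesis by blast
  qed
  have "\<exists>n. interior (E n) \<noteq> {}"
  proof (rule ccontr)
    assume "\<not> ?thesis"
    then have "(euclidean :: ('a \<Rightarrow>\<^sub>L real) topology) interior_of \<Union>(range E) = {}"
      using cl completely_metrizable_space_euclidean by (intro Baire_category_alt) auto
    then show False unfolding cover by simp
  qed
  then obtain n g0 e where e: "e > 0" "cball g0 e \<subseteq> E n"
    by (metis ex_in_conv mem_interior_cball)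
  show ?thesis unfolding bounded_iff
  proof (intro exI ballI)
    fix x assume x: "x \<in> B"
    obtain g :: "'a \<Rightarrow>\<^sub>L real" where g: "norm g \<le> 1" "norm x \<le> blinfun_apply g x"
      using norming_functional by blast
    \<comment> \<open>Both points lie in \<open>E n\<close>, so subtracting their values at
      \<open>x\<close> bounds \<open>e * blinfun_apply g x\<close> by
      \<open>2 * real n\<close>.\<close>
    have "g0 + e *\<^sub>R g \<in> cball g0 e" "g0 \<in> cball g0 e"
      using e g(1) by (auto simp: dist_norm)
    then have "\<bar>blinfun_apply (g0 + e *\<^sub>R g) x\<bar> \<le> n" "\<bar>blinfun_apply g0 x\<bar> \<le> n"
      using e(2) x unfolding E_def by blast+
    then have "e * blinfun_apply g x \<le> 2 * real n"
      by (simp add: plus_blinfun.rep_eq scaleR_blinfun.rep_eq)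
    then have "blinfun_apply g x \<le> 2 * real n / e" using e(1) by (simp add: field_simps)
    with g(2) show "norm x \<le> 2 * real n / e" by simp
  qed
qed

subsection \<open>The weak topology\<close>

lemma topspace_weak_topology [simp]: "topspace weak_topology = UNIV"
proof -
  have "UNIV \<in> {blinfun_apply g -` V | (g :: 'a \<Rightarrow>\<^sub>L real) V. open V}"
    by (intro CollectI exI[of _ 0] exI[of _ UNIV]) auto
  then show ?thesis unfolding weak_topology_def topology_generated_by_topspace by blast
qed

lemma continuous_map_weak_apply:
  fixes g :: "'a::real_normed_vector \<Rightarrow>\<^sub>L real"
  shows "continuous_map weak_topology euclidean (blinfun_apply g)"
proof -
  have "openin weak_topology (blinfun_apply g -` V)" if "open V" for V
    unfolding weak_topology_def using that by (intro topology_generated_by_Basis) blast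
  then show ?thesis by (simp add: continuous_map_def vimage_def)
qed

text \<open>Universal property of an initial topology: preimages of the generating sets decide
  continuity.\<close>

lemma continuous_map_into_weak:
  fixes h :: "'b \<Rightarrow> 'a::real_normed_vector"
  assumes "\<And>g :: 'a \<Rightarrow>\<^sub>L real. continuous_map X euclidean (\<lambda>x. blinfun_apply g (h x))"
  shows "continuous_map X weak_topology h"
  unfolding weak_topology_def
proof (rule continuous_on_generated_topo)
  fix U :: "'a set"
  assume "U \<in> {blinfun_apply g -` V | (g :: 'a \<Rightarrow>\<^sub>L real) V. open V}"
  then obtain g :: "'a \<Rightarrow>\<^sub>L real" and V where U: "U = blinfun_apply g -` V" "open V" by blast
  have "openin X {x \<in> topspace X. blinfun_apply g (h x) \<in> V}"
    using assms[of g] U(2) by (simp add: continuous_map_def)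
  moreover have "h -` U \<inter> topspace X = {x \<in> topspace X. blinfun_apply g (h x) \<in> V}"
    using U(1) by auto
  ultimately show "openin X (h -` U \<inter> topspace X)" by simp
next
  show "h ` topspace X \<subseteq> \<Union> {blinfun_apply g -` V | (g :: 'a \<Rightarrow>\<^sub>L real) V. open V}"
    using topspace_weak_topology unfolding weak_topology_def topology_generated_by_topspace by blast
qed

text \<open>Every functional maps the compact weak closure onto a compact set of reals, so
  \<open>B\<close> is weakly bounded.\<close>

lemma weakly_compact_imp_bounded:
  assumes "weakly_compact B"
  shows "bounded B"
proof (rule weakly_bounded_imp_bounded)
  fix g :: "'a \<Rightarrow>\<^sub>L real"
  have "compactin euclidean (blinfun_apply g ` (weak_topology closure_of B))"
    using assms by (intro image_compactin[OF _ continuous_map_weak_apply])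
      (simp add: weakly_compact_def)
  then have "bounded (blinfun_apply g ` (weak_topology closure_of B))"
    by (simp add: compact_imp_bounded)
  then show "bounded (blinfun_apply g ` B)"
    by (rule bounded_subset) (simp add: closure_of_subset image_mono)
qed

section \<open>Riesz representation and weak compactness of Hilbert balls\<close>

text \<open>The representing vector is the minimizer of the quadratic functional \<open>J\<close>. A
  minimizing sequence is Cauchy by the parallelogram law, and vanishing of the first variation at
  its limit is the claim.\<close>

lemma riesz_representation:
  fixes g :: "'h::{real_inner, banach} \<Rightarrow>\<^sub>L real"
  obtains u where "\<And>w. blinfun_apply g w = u \<bullet> w"
proof -
  define J where "J w = w \<bullet> w - 2 * blinfun_apply g w" for w
  define m where "m = Inf (range J)"
  have "- (norm g)\<^sup>2 \<le> J w" for w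
  proof -
    have "blinfun_apply g w \<le> norm g * norm w"
      using norm_blinfun[of g w] by simp
    moreover have "0 \<le> (norm w - norm g)\<^sup>2" by simp
    ultimately show ?thesis
      by (simp add: J_def power2_diff dot_square_norm algebra_simps)
  qed
  then have bdd: "bdd_below (range J)" by (intro bdd_belowI2) auto
  then have m_le: "m \<le> J w" for w
    unfolding m_def by (intro cInf_lower) auto
  have "\<exists>w. J w < m + inverse (Suc n)" for n
    using cInf_lessD[of "range J" "m + inverse (Suc n)"] by (auto simp: m_def)
  then obtain w where w: "\<And>n. J (w n) < m + inverse (Suc n)" by metis
  have parallelogram: "(norm (a - b))\<^sup>2 \<le> 2 * (J a - m) + 2 * (J b - m)" for a b
  proof -
    have "(norm (a - b))\<^sup>2 = 2 * J a + 2 * J b - 4 * J ((1/2) *\<^sub>R (a + b))"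
      by (simp add: J_def power2_norm_eq_inner blinfun.bilinear_simps algebra_simps inner_commute)
    with m_le[of "(1/2) *\<^sub>R (a + b)"] show ?thesis by simp
  qed
  have "Cauchy w"
  proof (rule metric_CauchyI)
    fix e :: real assume e: "0 < e"
    obtain N where N: "inverse (real (Suc N)) < e\<^sup>2 / 4"
      using reals_Archimedean[of "e\<^sup>2 / 4"] e by auto
    have small: "J (w n) - m < e\<^sup>2 / 4" if "N \<le> n" for n
    proof -
      have "inverse (real (Suc n)) \<le> inverse (real (Suc N))" using that by (simp add: field_simps)
      with w[of n] N show ?thesis by linarith
    qed
    have "dist (w i) (w j) < e" if "N \<le> i" "N \<le> j" for i j
    proof -
      have "(norm (w i - w j))\<^sup>2 < e\<^sup>2"
        using parallelogram[of "w i" "w j"] small[OF that(1)] small[OF that(2)] by (simp add: field_simps)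
      then show ?thesis using e by (simp add: dist_norm power2_less_imp_less)
    qed
    then show "\<exists>M. \<forall>i\<ge>M. \<forall>j\<ge>M. dist (w i) (w j) < e" by blast
  qed
  then obtain u where u: "w \<longlonglongrightarrow> u" by (auto simp: convergent_eq_Cauchy[symmetric])
  have "(\<lambda>n. J (w n)) \<longlonglongrightarrow> J u"
    unfolding J_def by (intro tendsto_intros u)
  moreover have "(\<lambda>n. m + inverse (Suc n)) \<longlonglongrightarrow> m + 0"
    by (intro tendsto_add tendsto_const LIMSEQ_inverse_real_of_nat)
  ultimately have "J u \<le> m + 0"
    by (rule LIMSEQ_le) (use w less_imp_le in blast)
  then have min: "J u \<le> J v" for v using m_le[of v] by simp
  show thesis
  proof
    fix v
    define d where "d = u \<bullet> v - blinfun_apply g v"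
    \<comment> \<open>Nearly the optimal step of the quadratic along \<open>v\<close>; the added 1
      avoids division by zero at \<open>v = 0\<close>.\<close>
    define t where "t = - d / (v \<bullet> v + 1)"
    have pos: "0 < v \<bullet> v + 1" using inner_ge_zero[of v] by linarith
    have "J (u + t *\<^sub>R v) = J u + 2 * t * d + t\<^sup>2 * (v \<bullet> v)"
      by (simp add: J_def d_def blinfun.bilinear_simps algebra_simps inner_commute power2_eq_square)
    with min[of "u + t *\<^sub>R v"] have "0 \<le> 2 * t * d + t\<^sup>2 * (v \<bullet> v)" by simp
    also have "\<dots> \<le> 2 * t * d + t\<^sup>2 * (v \<bullet> v + 1)" by (simp add: algebra_simps)
    also have "\<dots> = t * (2 * d + t * (v \<bullet> v + 1))" by (simp add: algebra_simps power2_eq_square)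
    also have "t * (v \<bullet> v + 1) = - d" using pos by (simp add: t_def)
    also have "t * (2 * d + - d) = - d\<^sup>2 / (v \<bullet> v + 1)" by (simp add: t_def power2_eq_square)
    finally have "d\<^sup>2 \<le> 0" using pos by (simp add: field_simps)
    then show "blinfun_apply g v = u \<bullet> v" by (simp add: d_def)
  qed
qed

text \<open>Banach-Alaoglu combined with Riesz: the linear \<open>F\<close> with
  \<open>\<bar>F v\<bar> \<le> R * norm v\<close> form a closed subset of a Tychonoff product, and
  the ball is the image of this compact set under the representation map. A negative radius gives
  the empty ball.\<close>

lemma compactin_weak_cball:
  "compactin weak_topology (cball (0 :: 'h::{real_inner, banach}) R)"
proof (cases "0 \<le> R")
  case True
  define P :: "('h \<Rightarrow> real) set" where "P = (\<Pi>\<^sub>E v\<in>UNIV. cball 0 (R * norm v))"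
  define K where "K = P \<inter> {F. linear F}"
  have "compactin (product_topology (\<lambda>_. euclidean) UNIV) P"
    unfolding P_def by (subst compactin_PiE) simp
  then have "compact P" by (simp add: euclidean_product_topology)
  moreover have "closed {F :: 'h \<Rightarrow> real. linear F}"
    unfolding linear_iff
    by (intro closed_Collect_conj closed_Collect_all closed_Collect_eq continuous_on_add
        continuous_on_scaleR continuous_on_const continuous_on_product_coordinates)
  ultimately have "compact K" unfolding K_def by (rule compact_Int_closed)
  then have K: "compactin (top_of_set K) K" by (simp add: compactin_subtopology)
  have K_bound: "\<bar>F v\<bar> \<le> R * norm v" if "F \<in> K" for F v
    using that by (auto simp: K_def P_def)
  have "\<exists>u. \<forall>v. F v = u \<bullet> v" if F: "F \<in> K" for F
  proof -
    have lin: "linear F" using F by (simp add: K_def)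
    have "bounded_linear F"
      using K_bound[OF F] linear_add[OF lin] linear_scale[OF lin]
      by (intro bounded_linear_intro[where K = R]) (auto simp: mult.commute)
    then have "blinfun_apply (Blinfun F) = F" by (rule bounded_linear_Blinfun_apply)
    then show ?thesis
      using riesz_representation[of "Blinfun F"] by auto
  qed
  then obtain G where G: "\<And>F v. F \<in> K \<Longrightarrow> F v = G F \<bullet> v" by metis
  \<comment> \<open>A functional represented by \<open>u\<close> takes at \<open>G F\<close> the
    value \<open>F u\<close>, which is a coordinate projection of the product.\<close>
  have "continuous_map (top_of_set K) weak_topology G"
  proof (rule continuous_map_into_weak)
    fix g :: "'h \<Rightarrow>\<^sub>L real"
    obtain u where u: "\<And>w. blinfun_apply g w = u \<bullet> w" using riesz_representation by blast
    have "continuous_map (top_of_set K) euclidean (\<lambda>F. F u)"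
      by (simp add: continuous_on_product_coordinates continuous_on_subset[OF _ subset_UNIV])
    moreover have "blinfun_apply g (G F) = F u" if "F \<in> K" for F
      using u G[OF that] by (simp add: inner_commute)
    ultimately show "continuous_map (top_of_set K) euclidean (\<lambda>F. blinfun_apply g (G F))"
      by (simp cong: continuous_on_cong)
  qed
  then have "compactin weak_topology (G ` K)" by (rule image_compactin[OF K])
  moreover have "G ` K = cball 0 R"
  proof (intro equalityI subsetI)
    fix w assume "w \<in> G ` K"
    then obtain F where F: "F \<in> K" "w = G F" by blast
    have "norm w * norm w \<le> R * norm w"
      using K_bound[OF F(1), of w] G[OF F(1), of w] F(2)
      by (simp add: dot_square_norm power2_eq_square)
    then show "w \<in> cball 0 R" using True by (cases "w = 0") auto
  next
    fix w :: 'h assume w: "w \<in> cball 0 R"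
    have "\<bar>w \<bullet> v\<bar> \<le> R * norm v" for v
      using Cauchy_Schwarz_ineq2[of w v] w
      by (meson mem_cball_0 mult_right_mono norm_ge_zero order.trans)
    then have F: "(\<lambda>v. w \<bullet> v) \<in> K"
      by (auto simp: K_def P_def linear_iff inner_add_right)
    have "G (\<lambda>v. w \<bullet> v) \<bullet> v = w \<bullet> v" for v by (rule G[OF F, symmetric])
    then have "G (\<lambda>v. w \<bullet> v) = w" using vector_eq_rdot by blast
    with F show "w \<in> G ` K" by force
  qed
  ultimately show ?thesis by simp
qed simp

section \<open>Weak lower semicontinuity and weak limits\<close>

text \<open>A functional on the product splits as \<open>g (x, 0) + g (0, z)\<close>. Hence sets
  that are open or closed in the weak topology of the product space remain so in the product of the
  weak topologies, where boxes \<open>U \<times> V\<close> are available.\<close>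

lemma continuous_map_prod_weak:
  "continuous_map (prod_topology weak_topology weak_topology) weak_topology
    (\<lambda>p :: 'a::real_normed_vector \<times> 'b::real_normed_vector. p)"
proof (rule continuous_map_into_weak)
  fix g :: "('a \<times> 'b) \<Rightarrow>\<^sub>L real"
  define g1 where "g1 = Blinfun (\<lambda>x. blinfun_apply g (x, 0))"
  define g2 where "g2 = Blinfun (\<lambda>z. blinfun_apply g (0, z))"
  have "blinfun_apply g1 = (\<lambda>x. blinfun_apply g (x, 0))"
    "blinfun_apply g2 = (\<lambda>z. blinfun_apply g (0, z))"
    unfolding g1_def g2_def
    by (intro bounded_linear_Blinfun_apply bounded_linear_intros)+
  then have "blinfun_apply g p = blinfun_apply g1 (fst p) + blinfun_apply g2 (snd p)" for p
    by (simp add: blinfun.add_right[symmetric])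
  moreover have "continuous_map (prod_topology weak_topology weak_topology) euclidean
      (\<lambda>p. blinfun_apply g1 (fst p) + blinfun_apply g2 (snd p))"
    using continuous_map_compose[OF continuous_map_fst continuous_map_weak_apply[of g1]]
      continuous_map_compose[OF continuous_map_snd continuous_map_weak_apply[of g2]]
    by (intro continuous_map_add) (simp_all add: o_def)
  ultimately show "continuous_map (prod_topology weak_topology weak_topology) euclidean
      (\<lambda>p. blinfun_apply g p)"
    by simp
qed

text \<open>The sublevel set is the slice of the epigraph at height \<open>t\<close>, pulled back
  along the weakly continuous map sending \<open>x\<close> to \<open>(x, t)\<close>.\<close>

lemma closedin_weak_sublevel:
  fixes g :: "'a::real_normed_vector \<Rightarrow> ereal"
  assumes "w_lsc g"
  shows "closedin weak_topology {x. g x \<le> ereal t}"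
proof -
  have "continuous_map weak_topology (prod_topology weak_topology weak_topology)
      (\<lambda>x :: 'a. (x, t))"
    by (intro continuous_map_pairedI) auto
  from continuous_map_compose[OF this continuous_map_prod_weak]
  have "continuous_map weak_topology weak_topology (\<lambda>x :: 'a. (x, t))" by (simp add: o_def)
  from closedin_continuous_map_preimage[OF this] assms show ?thesis
    by (fastforce simp: w_lsc_def)
qed

lemma openin_prod_weak_superlevel:
  fixes f :: "'a::real_normed_vector \<times> 'b::real_normed_vector \<Rightarrow> ereal"
  assumes "w_lsc f"
  shows "openin (prod_topology weak_topology weak_topology) {p. ereal t < f p}"
proof -
  have "closedin (prod_topology weak_topology weak_topology) {p. f p \<le> ereal t}"
    using closedin_continuous_map_preimage[OF continuous_map_prod_weak
        closedin_weak_sublevel[OF assms]] by simp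
  then show ?thesis by (simp add: closedin_def Diff_eq Compl_eq not_le)
qed

lemma coercive_imp_conditionally_coercive:
  assumes "coercive \<sigma>"
  shows "conditionally_coercive \<sigma>"
proof -
  have "eventually (\<lambda>z. ereal 1 < \<sigma> z) at_infinity"
    using assms unfolding coercive_def by (simp add: order_tendstoD)
  then obtain b where b: "\<And>z. b \<le> norm z \<Longrightarrow> ereal 1 < \<sigma> z"
    by (auto simp: eventually_at_infinity)
  have "{z. \<sigma> z \<le> ereal 1} \<subseteq> cball 0 b"
    using b by (force simp: not_le[symmetric])
  then have "bounded {z. \<sigma> z \<le> ereal 1}" by (rule bounded_subset[OF bounded_cball])
  then show ?thesis unfolding conditionally_coercive_def by (intro exI[of _ 1]) simp
qed

text \<open>If no sublevel set within the ball entered the neighbourhood \<open>U\<close>, the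
  nested nonempty sets \<open>C n\<close> would share a point by weak compactness, which would be a
  minimizer of \<sigma> other than 0.\<close>

lemma minimizing_sequence_weak_limit:
  fixes \<sigma> :: "'h::{real_inner, banach} \<Rightarrow> ereal"
  assumes lsc: "w_lsc \<sigma>" and zero: "\<sigma> 0 = 0" and argmin: "argmin_set \<sigma> = {0}"
    and coercive: "conditionally_coercive \<sigma>"
    and lim: "((\<lambda>k. \<sigma> (z k)) \<longlongrightarrow> 0) F"
  shows "limitin weak_topology z 0 F"
  unfolding limitin_def
proof (intro conjI allI impI)
  fix U :: "'h set" assume U: "openin weak_topology U \<and> 0 \<in> U"
  obtain b where b: "0 < b" "bounded {w. \<sigma> w \<le> ereal b}"
    using coercive by (auto simp: conditionally_coercive_def)
  then obtain R where R: "\<And>w. \<sigma> w \<le> ereal b \<Longrightarrow> norm w \<le> R" by (auto simp: bounded_iff)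
  let ?K = "cball (0 :: 'h) R"
  define C where "C n = ?K \<inter> ({w. \<sigma> w \<le> ereal (inverse (Suc n))} - U)" for n
  have "\<exists>n. C n = {}"
  proof (rule ccontr)
    assume "\<not> ?thesis"
    then have ne: "C n \<noteq> {}" for n by blast
    have "(\<Inter>n. C n) \<noteq> {}"
    proof (rule compact_space_imp_nest[OF _ _ ne])
      show "compact_space (subtopology weak_topology ?K)"
        by (simp add: compactin_weak_cball compact_space_subtopology)
      show "closedin (subtopology weak_topology ?K) (C n)" for n
        unfolding C_def
        by (intro closedin_subtopology_Int_closed closedin_diff closedin_weak_sublevel lsc)
          (use U in blast)
      show "decseq C"
        unfolding decseq_Suc_iff C_def
      proof (intro allI subsetI)
        fix n w assume w: "w \<in> ?K \<inter> ({w. \<sigma> w \<le> ereal (inverse (Suc (Suc n)))} - U)"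
        then have "\<sigma> w \<le> ereal (inverse (Suc (Suc n)))" by blast
        also have "\<dots> \<le> ereal (inverse (Suc n))" by (simp add: field_simps)
        finally show "w \<in> ?K \<inter> ({w. \<sigma> w \<le> ereal (inverse (Suc n))} - U)" using w by blast
      qed
    qed
    then obtain w where w: "\<And>n. w \<in> C n" by blast
    have w_le: "\<sigma> w \<le> ereal 0"
    proof (rule tendsto_le[OF sequentially_bot _ tendsto_const])
      show "(\<lambda>n. ereal (inverse (Suc n))) \<longlonglongrightarrow> ereal 0"
        using LIMSEQ_inverse_real_of_nat by (intro tendsto_ereal)
      show "\<forall>\<^sub>F n in sequentially. \<sigma> w \<le> ereal (inverse (Suc n))" using w by (simp add: C_def)
    qed
    have "0 \<le> \<sigma> v" for v
      using argmin by (auto simp: argmin_set_def zero[symmetric])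
    then have "w \<in> argmin_set \<sigma>"
      using order.trans[OF w_le[folded zero_ereal_def]] by (simp add: argmin_set_def)
    then show False using w U argmin by (auto simp: C_def)
  qed
  then obtain n where n: "C n = {}" by blast
  \<comment> \<open>The bound \<open>b\<close> puts \<open>z k\<close> into the ball, the other one
    into the sublevel set that \<open>C n = {}\<close> confines to \<open>U\<close>.\<close>
  have "0 < min (ereal b) (ereal (inverse (Suc n)))" using b(1) by simp
  then have "\<forall>\<^sub>F k in F. \<sigma> (z k) < min (ereal b) (ereal (inverse (Suc n)))"
    by (rule order_tendstoD(2)[OF lim])
  then show "\<forall>\<^sub>F k in F. z k \<in> U"
  proof eventually_elim
    case (elim k)
    then have "norm (z k) \<le> R" "\<sigma> (z k) \<le> ereal (inverse (Suc n))"
      using R[of "z k"] by (auto simp del: of_nat_Suc)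
    then show ?case using n unfolding C_def by (auto simp del: of_nat_Suc)
  qed
qed simp

text \<open>Tube lemma: the open superlevel set contains the compact set formed by the weak closure
  of \<open>B\<close> and the point 0, hence a box around it. This bounds \<open>f\<close> from
  below along \<open>x\<close> without extracting a weakly convergent subsequence.\<close>

lemma w_lsc_eventually_greater:
  fixes f :: "'a::real_normed_vector \<times> 'b::real_normed_vector \<Rightarrow> ereal"
  assumes lsc: "w_lsc f" and B: "weakly_compact B"
    and greater: "\<And>u. ereal t < f (u, 0)"
    and z: "limitin weak_topology z 0 F" and x: "\<forall>\<^sub>F k in F. x k \<in> B"
  shows "\<forall>\<^sub>F k in F. ereal t < f (x k, z k)"
proof -
  have zero: "compactin weak_topology {0 :: 'b}" by (simp add: compactin_sing)
  have sub: "(weak_topology closure_of B) \<times> {0} \<subseteq> {p. ereal t < f p}" using greater by auto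
  obtain U V where "openin weak_topology U" and V: "openin weak_topology V"
    and U: "weak_topology closure_of B \<subseteq> U" and "{0} \<subseteq> V" and UV: "U \<times> V \<subseteq> {p. ereal t < f p}"
    by (rule Wallace_theorem_prod_topology[OF B[unfolded weakly_compact_def] zero
        openin_prod_weak_superlevel[OF lsc] sub])
  have "B \<subseteq> U" using U closure_of_subset[of B weak_topology] by auto
  have "\<forall>\<^sub>F k in F. z k \<in> V" using z V \<open>{0} \<subseteq> V\<close> by (auto simp: limitin_def)
  then show ?thesis
    using x by eventually_elim (use UV \<open>B \<subseteq> U\<close> in blast)
qed

text \<open>Otherwise some real \<open>t\<close> lies strictly between \<open>m\<close> and
  \<open>f (p, w)\<close>, and \<open>f\<close> exceeds \<open>t\<close> on a box around
  \<open>(p, w)\<close>. This box is visited infinitely often, although \<open>f (x k, z k)\<close>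
  is eventually at most \<open>t\<close>.\<close>

lemma w_lsc_accumulation_point_le:
  fixes f :: "'a::real_normed_vector \<times> 'b::real_normed_vector \<Rightarrow> ereal"
  assumes lsc: "w_lsc f" and z: "limitin weak_topology z w sequentially"
    and p: "weak_accumulation_point x p"
    and le: "\<And>t. m < ereal t \<Longrightarrow> \<forall>\<^sub>F k in sequentially. f (x k, z k) \<le> ereal t"
  shows "f (p, w) \<le> m"
proof (rule ccontr)
  assume "\<not> ?thesis"
  then obtain t where t: "m < ereal t" "ereal t < f (p, w)"
    using ereal_dense2 by (metis not_le)
  from t(2) have "(p, w) \<in> {p. ereal t < f p}" by simp
  with openin_prod_weak_superlevel[OF lsc, of t]
  obtain U V where U: "openin weak_topology U" "p \<in> U" and V: "openin weak_topology V" "w \<in> V"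
    and UV: "U \<times> V \<subseteq> {p. ereal t < f p}"
    unfolding openin_prod_topology_alt by blast
  have "\<exists>\<^sub>F k in sequentially. x k \<in> U"
    using p U by (auto simp: weak_accumulation_point_def cofinite_eq_sequentially)
  moreover have "\<forall>\<^sub>F k in sequentially. z k \<in> V" using z V by (auto simp: limitin_def)
  then have "\<forall>\<^sub>F k in sequentially. z k \<in> V \<and> f (x k, z k) \<le> ereal t"
    using le[OF t(1)] by (rule eventually_conj)
  ultimately have "\<exists>\<^sub>F k in sequentially. x k \<in> U \<and> z k \<in> V \<and> f (x k, z k) \<le> ereal t"
    by (rule frequently_eventually_frequently)
  then obtain k where k: "x k \<in> U" "z k \<in> V" "f (x k, z k) \<le> ereal t"
    using frequently_ex by blast
  then have "ereal t < f (x k, z k)" using UV by blast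
  with k(3) show False by simp
qed

subsection \<open>The subgradient method\<close>

text \<open>Each retry multiplies the tolerance by \<open>\<delta> \<le> 1\<close>, so the final
  tolerance is squeezed between 0 and the initial one and inherits its convergence to 0.\<close>

lemma dsg_step1_leave:
  assumes "dsg_step1 f A \<sigma> \<epsilon> \<delta> y c \<rho> r x z" and "0 \<le> \<rho>" "0 \<le> \<delta>" "\<delta> \<le> 1"
  shows "(x, z) \<in> approx_minimizers f A \<sigma> r y c \<and> (z \<noteq> 0 \<or> r \<le> \<epsilon>) \<and> 0 \<le> r \<and> r \<le> \<rho>"
  using assms
proof (induction rule: dsg_step1.induct)
  case (leave x z r)
  then show ?case by simp
next
  case (retry x' \<rho> r x z)
  moreover have "\<delta> * \<rho> \<le> \<rho>" using retry.prems by (simp add: mult_left_le_one_le)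
  ultimately show ?case by auto
qed

lemma lagrangian_zero:
  assumes "\<sigma> 0 = 0" "A 0 = 0"
  shows "lagrangian f A \<sigma> y c (u, 0) = f (u, 0)"
  using assms by (simp add: lagrangian_def scale_ereal_def zero_ereal_def[symmetric])

text \<open>The infimum defining the dual function includes the points \<open>(u, 0)\<close>, where
  coupling and penalty vanish.\<close>

lemma weak_duality:
  assumes "\<sigma> 0 = 0" "A 0 = 0"
  shows "dual_fun f A \<sigma> y c \<le> primal_value (\<lambda>u. f (u, 0))"
  unfolding primal_value_def dual_fun_def
proof (intro INF_greatest)
  fix u
  show "(INF p. lagrangian f A \<sigma> y c p) \<le> f (u, 0)"
    using INF_lower[of "(u, 0)" UNIV "lagrangian f A \<sigma> y c"]
    by (simp add: lagrangian_zero[of \<sigma> A, OF assms])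
qed

lemma dual_value_le_primal_value:
  assumes "\<sigma> 0 = 0" "A 0 = 0"
  shows "dual_value f A \<sigma> \<le> primal_value (\<lambda>u. f (u, 0))"
  unfolding dual_value_def by (intro SUP_least) (auto simp: weak_duality[of \<sigma> A, OF assms])

text \<open>Both claims follow from
  \<open>\<phi> x \<le> dual_fun f A \<sigma> y c + ereal \<epsilon>\<close>: weak duality on its
  right side gives primal optimality, and the dual value lying below \<open>\<phi> x\<close> gives
  dual optimality.\<close>

lemma approx_minimizer_zero_eps_optimal:
  assumes zero: "\<sigma> 0 = 0" "A 0 = 0" and f0: "\<And>u. f (u, 0) = \<phi> u"
    and min: "(x, 0) \<in> approx_minimizers f A \<sigma> r y c" and r: "r \<le> \<epsilon>" and c: "0 \<le> c"
  shows "eps_optimal_primal \<phi> \<epsilon> x" "eps_optimal_dual f A \<sigma> \<epsilon> y c"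
proof -
  have \<phi>: "(\<lambda>u. f (u, 0)) = \<phi>" by (simp add: f0)
  have "\<phi> x \<le> dual_fun f A \<sigma> y c + ereal r"
    using min by (simp add: approx_minimizers_def lagrangian_zero[of \<sigma> A, OF zero] f0)
  also have "\<dots> \<le> dual_fun f A \<sigma> y c + ereal \<epsilon>" using r by (intro add_left_mono) simp
  finally have le: "\<phi> x \<le> dual_fun f A \<sigma> y c + ereal \<epsilon>" .
  also have "\<dots> \<le> primal_value \<phi> + ereal \<epsilon>"
    using weak_duality[of \<sigma> A, OF zero, of f y c] by (intro add_right_mono) (simp add: \<phi>)
  finally show "eps_optimal_primal \<phi> \<epsilon> x" unfolding eps_optimal_primal_def .
  have "dual_value f A \<sigma> \<le> primal_value \<phi>"
    using dual_value_le_primal_value[of \<sigma> A, OF zero, of f] by (simp add: \<phi>)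
  also have "\<dots> \<le> \<phi> x" unfolding primal_value_def by (rule INF_lower) simp
  also note le
  finally have "dual_value f A \<sigma> - ereal \<epsilon> \<le> dual_fun f A \<sigma> y c"
    by (simp add: ereal_minus_le)
  with c show "eps_optimal_dual f A \<sigma> \<epsilon> y c" by (simp add: eps_optimal_dual_def)
qed

section \<open>Growth of the dual iterates and penalty estimates\<close>

text \<open>In step \<open>k\<close> the point \<open>y\<close> moves by at most
  \<open>s k * S k\<close>, while \<open>c\<close> rises by at least \<open>1 + b\<close> times that
  amount. The surplus is at least \<open>b\<close> times the divergent sum of the \<theta>
  values.\<close>

lemma dual_iterates_growth:
  fixes y a :: "nat \<Rightarrow> 'h::real_normed_vector" and c s S \<alpha> \<theta> :: "nat \<Rightarrow> real"
  assumes y: "\<And>k. y (Suc k) = y k - s k *\<^sub>R a k"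
    and c: "\<And>k. c (Suc k) = c k + (\<alpha> k + 1) * s k * S k"
    and s: "\<And>k. 0 \<le> s k" and a: "\<And>k. norm (a k) \<le> S k"
    and b: "0 < b" "\<And>k. b \<le> \<alpha> k" and \<theta>: "\<And>k. \<theta> k \<le> s k * S k"
    and div: "filterlim (\<lambda>n. \<Sum>j<n. \<theta> j) at_top sequentially"
  shows "c 0 \<le> c k" "filterlim c at_top sequentially"
    "filterlim (\<lambda>k. c k - c 0 - norm (y k - y 0)) at_top sequentially"
proof -
  have sS: "0 \<le> s k * S k" for k
    using s[of k] norm_ge_zero[of "a k"] a[of k] by (meson mult_nonneg_nonneg order.trans)
  have le: "(\<Sum>j<k. \<theta> j) \<le> (\<Sum>j<k. s j * S j)" for k by (intro sum_mono \<theta>)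
  have dy: "norm (y k - y 0) \<le> (\<Sum>j<k. s j * S j)" for k
  proof (induction k)
    case (Suc k)
    have "norm (y (Suc k) - y 0) = norm ((y k - y 0) - s k *\<^sub>R a k)" by (simp add: y algebra_simps)
    also have "\<dots> \<le> norm (y k - y 0) + s k * norm (a k)"
      using norm_triangle_ineq4[of "y k - y 0" "s k *\<^sub>R a k"] s[of k] by simp
    also have "\<dots> \<le> (\<Sum>j<Suc k. s j * S j)"
      using Suc mult_left_mono[OF a[of k] s[of k]] by simp
    finally show ?case .
  qed simp
  have dc: "(1 + b) * (\<Sum>j<k. s j * S j) \<le> c k - c 0" for k
  proof (induction k)
    case (Suc k)
    have "(1 + b) * (s k * S k) \<le> (\<alpha> k + 1) * (s k * S k)"
      using b(2)[of k] sS[of k] by (intro mult_right_mono) auto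
    with Suc show ?case by (simp add: c algebra_simps)
  qed simp
  have nonneg: "0 \<le> (\<Sum>j<k. s j * S j)" for k by (intro sum_nonneg sS)
  have "0 \<le> (1 + b) * (\<Sum>j<k. s j * S j)" using nonneg[of k] b(1) by simp
  with dc[of k] show "c 0 \<le> c k" by linarith
  have gap: "b * (\<Sum>j<k. \<theta> j) \<le> c k - c 0 - norm (y k - y 0)" for k
  proof -
    have "b * (\<Sum>j<k. \<theta> j) \<le> b * (\<Sum>j<k. s j * S j)" using le b(1) by (intro mult_left_mono) auto
    with dc[of k] dy[of k] show ?thesis by (simp add: algebra_simps)
  qed
  have "filterlim (\<lambda>k. b * (\<Sum>j<k. \<theta> j)) at_top sequentially"
    using b(1) div by (intro filterlim_tendsto_pos_mult_at_top[OF tendsto_const])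
  then show gap_lim: "filterlim (\<lambda>k. c k - c 0 - norm (y k - y 0)) at_top sequentially"
    by (rule filterlim_at_top_mono) (simp add: gap)
  have "filterlim (\<lambda>k. c 0 + (c k - c 0 - norm (y k - y 0))) at_top sequentially"
    by (rule filterlim_tendsto_add_at_top[OF tendsto_const gap_lim])
  then show "filterlim c at_top sequentially"
    by (rule filterlim_at_top_mono) simp
qed

lemma filterlim_at_top_unbounded_Pair:
  fixes c :: "nat \<Rightarrow> real" and y :: "nat \<Rightarrow> 'h::real_normed_vector"
  assumes "filterlim c at_top sequentially"
  shows "\<not> bounded (range (\<lambda>k. (y k, c k)))"
proof
  assume "bounded (range (\<lambda>k. (y k, c k)))"
  then obtain M where M: "\<And>k. norm (y k, c k) \<le> M" by (auto simp: bounded_iff)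
  have "c k \<le> M" for k
  proof -
    have "norm (c k) \<le> norm (y k, c k)" using norm_snd_le[of "c k" "y k"] by simp
    with M[of k] show ?thesis by simp
  qed
  moreover have "\<forall>\<^sub>F k in sequentially. M + 1 \<le> c k" using assms by (simp add: filterlim_at_top)
  then obtain k where "M + 1 \<le> c k" using eventually_happens'[OF sequentially_bot] by blast
  ultimately show False by (smt (verit))
qed

text \<open>The gap \<open>c k - c 0 - norm (y k - y 0)\<close> plays the role of an additional penalty
  parameter for the Lagrangian at the initial dual point, and it tends to infinity.\<close>

lemma penalty_estimates:
  fixes y a :: "nat \<Rightarrow> 'h::real_inner" and c F S Q r :: "nat \<Rightarrow> real"
  assumes c0: "0 \<le> c 0" and a: "\<And>k. norm (a k) \<le> S k"
    and min: "\<And>k. F k - a k \<bullet> y k + c k * S k \<le> Q k + r k" and Q: "\<And>k. Q k \<le> m"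
    and low: "\<And>k. Q 0 \<le> F k - a k \<bullet> y 0 + c 0 * S k"
    and gap: "filterlim (\<lambda>k. c k - c 0 - norm (y k - y 0)) at_top sequentially"
    and r: "r \<longlonglongrightarrow> 0"
  shows "S \<longlonglongrightarrow> 0"
    and "\<forall>\<^sub>F k in sequentially. F k \<le> Q k + (r k + norm (y 0) * S k)"
proof -
  define D where "D k = c k - c 0 - norm (y k - y 0)" for k
  have S0: "0 \<le> S k" for k using norm_ge_zero[of "a k"] a[of k] by linarith
  \<comment> \<open>Cauchy-Schwarz exchanges \<open>y k\<close> for \<open>y 0\<close> at the price
    \<open>S k * norm (y k - y 0)\<close>; \<open>D k\<close> is what remains of
    \<open>c k - c 0\<close> after paying it.\<close>
  have main: "F k - a k \<bullet> y 0 + c 0 * S k + D k * S k \<le> Q k + r k" for k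
  proof -
    have "a k \<bullet> (y k - y 0) \<le> norm (a k) * norm (y k - y 0)" by (rule norm_cauchy_schwarz)
    also have "\<dots> \<le> S k * norm (y k - y 0)" using a[of k] by (intro mult_right_mono) auto
    finally show ?thesis using min[of k] by (simp add: D_def algebra_simps)
  qed
  have D_ge: "\<forall>\<^sub>F k in sequentially. K \<le> D k" for K
    using gap by (simp add: filterlim_at_top D_def)
  show "S \<longlonglongrightarrow> 0"
  proof (rule tendsto_sandwich)
    show "\<forall>\<^sub>F k in sequentially. 0 \<le> S k" by (simp add: S0)
    \<comment> \<open>The terms of \<open>main\<close> without \<open>D k\<close> are at least
      \<open>Q 0\<close>, which bounds \<open>D k * S k\<close>; eventually
      \<open>D k \<ge> 1\<close>, so division is safe.\<close>
    show "\<forall>\<^sub>F k in sequentially. S k \<le> (m + r k - Q 0) / D k"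
      using D_ge[of 1]
    proof eventually_elim
      case (elim k)
      have "D k * S k \<le> m + r k - Q 0" using main[of k] Q[of k] low[of k] by linarith
      with elim show ?case by (simp add: field_simps)
    qed
    have "(\<lambda>k. m + r k - Q 0) \<longlonglongrightarrow> m + 0 - Q 0" by (intro tendsto_intros r)
    then show "(\<lambda>k. (m + r k - Q 0) / D k) \<longlonglongrightarrow> 0"
      using gap unfolding D_def
      by (rule tendsto_divide_0[OF _ filterlim_at_top_imp_at_infinity])
  qed simp
  show "\<forall>\<^sub>F k in sequentially. F k \<le> Q k + (r k + norm (y 0) * S k)"
    using D_ge[of 0]
  proof eventually_elim
    case (elim k)
    have "a k \<bullet> y 0 \<le> norm (a k) * norm (y 0)" by (rule norm_cauchy_schwarz)
    also have "\<dots> \<le> S k * norm (y 0)" using a[of k] by (intro mult_right_mono) auto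
    finally have "a k \<bullet> y 0 \<le> norm (y 0) * S k" by (simp add: mult.commute)
    moreover have "0 \<le> c 0 * S k" "0 \<le> D k * S k" using c0 elim S0[of k] by simp_all
    ultimately show ?case using main[of k] by linarith
  qed
qed

section \<open>The two alternatives for DSG-2\<close>

theorem corollary4p3:
  fixes f :: "'a::banach \<times> 'h::{real_inner, banach} \<Rightarrow> ereal"
    and \<phi> :: "'a \<Rightarrow> ereal"
    and A :: "'h \<Rightarrow> 'h" and \<sigma> :: "'h \<Rightarrow> ereal"
    and \<epsilon> \<delta> \<beta> alpha_bar :: real and \<alpha> \<rho> \<theta> r s c :: "nat \<Rightarrow> real"
    and T :: enat and x :: "nat \<Rightarrow> 'a" and z y :: "nat \<Rightarrow> 'h"
  assumes "reflexive_space TYPE('a)"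
    and "proper_fun \<phi>" and "w_lsc \<phi>"
    and "\<And>a::real. weakly_compact {u. \<phi> u \<le> ereal a}"
    and "\<And>u. f (u, 0) = \<phi> u"
    and "proper_fun f" and "w_lsc f" and "weakly_level_compact f"
    and "proper_fun \<sigma>" and "w_lsc \<sigma>" and "\<sigma> 0 = 0" and "argmin_set \<sigma> = {0}"
    and "\<And>w. ereal (norm (A w)) \<le> \<sigma> w"
    and "\<And>v. w_usc (\<lambda>w. ereal (A w \<bullet> v))"
    and "\<exists>ybar cbar. 0 \<le> cbar \<and> dual_fun f A \<sigma> ybar cbar > -\<infinity>"
    and "DSG2_run f A \<sigma> \<epsilon> \<delta> \<alpha> \<rho> \<theta> \<beta> T r x z s y c"
    and "0 < alpha_bar" and "\<And>k. alpha_bar \<le> \<alpha> k"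
    and "coercive \<sigma> \<or> conditionally_coercive \<sigma>"
  defines "stops \<equiv> \<exists>kbar. T = enat kbar"
    and "dual_unbounded \<equiv> \<not> bounded {(y k, c k) | k. enat k \<le> T}"
  shows "(stops \<or> dual_unbounded) \<and> \<not> (stops \<and> dual_unbounded) \<and>
    (\<forall>kbar. T = enat kbar \<longrightarrow>
       eps_optimal_primal \<phi> \<epsilon> (x kbar) \<and>
       eps_optimal_dual f A \<sigma> \<epsilon> (y kbar) (c kbar) \<and>
       bounded {(y k, c k) | k. enat k \<le> T}) \<and>
    (dual_unbounded \<longrightarrow>
       limitin weak_topology z 0 sequentially \<and>
       (\<lambda>k. dual_fun f A \<sigma> (y k) (c k)) \<longlonglongrightarrow> primal_value \<phi> \<and>
       bounded (range x) \<and>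
       (\<forall>p. weak_accumulation_point x p \<longrightarrow> p \<in> argmin_set \<phi>))"
proof -
  note f0 = assms(5) and proper_f = assms(6) and lsc_f = assms(7) and level_f = assms(8)
    and lsc_\<sigma> = assms(10) and \<sigma>0 = assms(11) and argmin_\<sigma> = assms(12) and A_le = assms(13)
  have run: "0 \<le> c 0" "dual_fun f A \<sigma> (y 0) (c 0) > -\<infinity>" "0 \<le> \<delta>" "\<delta> \<le> 1" "\<And>k. 0 \<le> \<rho> k"
    "\<rho> \<longlonglongrightarrow> 0" "filterlim (\<lambda>n. \<Sum>j<n. \<theta> j) at_top sequentially"
    and steps: "\<And>k. enat k \<le> T \<Longrightarrow> dsg_step1 f A \<sigma> \<epsilon> \<delta> (y k) (c k) (\<rho> k) (r k) (x k) (z k)"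
    and stop: "\<And>k. enat k \<le> T \<Longrightarrow> T = enat k \<longleftrightarrow> z k = 0"
    and s: "\<And>k. enat k < T \<Longrightarrow> 0 < s k"
    and y: "\<And>k. enat k < T \<Longrightarrow> y (Suc k) = y k - s k *\<^sub>R A (z k)"
    and c: "\<And>k. enat k < T \<Longrightarrow>
      ereal (c (Suc k)) = ereal (c k) + ereal ((\<alpha> k + 1) * s k) * \<sigma> (z k)"
    and \<theta>: "\<And>k. enat k < T \<Longrightarrow> ereal (\<theta> k) / \<sigma> (z k) \<le> ereal (s k)"
    using assms(16) unfolding DSG2_run_def DSG_run_def by auto
  have \<alpha>: "0 < \<alpha> k" for k using assms(17) assms(18)[of k] by linarith
  have \<phi>: "(\<lambda>u. f (u, 0)) = \<phi>" by (simp add: f0)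
  have A0: "A 0 = 0" using A_le[of 0] by (simp add: \<sigma>0 zero_ereal_def)
  have \<sigma>_nonneg: "0 \<le> \<sigma> w" for w
    using A_le[of w] norm_ge_zero[of "A w"] order.trans[of 0 "ereal (norm (A w))" "\<sigma> w"] by simp
  have \<sigma>_pos: "0 < \<sigma> w" if "w \<noteq> 0" for w
  proof (rule ccontr)
    assume "\<not> 0 < \<sigma> w"
    then have "\<sigma> w = 0" using \<sigma>_nonneg[of w] by (simp add: order.antisym)
    then have "w \<in> argmin_set \<sigma>" using \<sigma>_nonneg by (simp add: argmin_set_def)
    with that argmin_\<sigma> show False by simp
  qed
  have step: "(x k, z k) \<in> approx_minimizers f A \<sigma> (r k) (y k) (c k)"
    "z k \<noteq> 0 \<or> r k \<le> \<epsilon>" "0 \<le> r k" "r k \<le> \<rho> k" if "enat k \<le> T" for k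
    using dsg_step1_leave[OF steps[OF that] run(5,3,4)] by auto
  define S where "S k = real_of_ereal (\<sigma> (z k))" for k
  have S: "\<sigma> (z k) = ereal (S k)" "0 < S k" "c (Suc k) = c k + (\<alpha> k + 1) * s k * S k"
    "\<theta> k \<le> s k * S k" if k: "enat k < T" for k
  proof -
    have "0 < \<sigma> (z k)" using stop[OF less_imp_le[OF k]] k by (intro \<sigma>_pos) auto
    \<comment> \<open>An infinite \<open>\<sigma> (z k)\<close> with this positive coefficient would
      make the update of \<open>c\<close> infinite, against its real left side.\<close>
    have "0 < (\<alpha> k + 1) * s k" using \<alpha>[of k] s[OF k] by simp
    then have "ereal ((\<alpha> k + 1) * s k) * \<infinity> = \<infinity>"
      by (simp only: ereal_mult_eq_PInfty) simp
    then have "\<sigma> (z k) \<noteq> \<infinity>" using c[OF k] by auto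
    then show *: "\<sigma> (z k) = ereal (S k)" using \<open>0 < \<sigma> (z k)\<close> unfolding S_def by (cases "\<sigma> (z k)") auto
    then show "0 < S k" using \<open>0 < \<sigma> (z k)\<close> by simp
    show "c (Suc k) = c k + (\<alpha> k + 1) * s k * S k" using c[OF k] by (simp add: *)
    show "\<theta> k \<le> s k * S k" using \<theta>[OF k] \<open>0 < S k\<close> by (simp add: * field_simps)
  qed
  have stopped: "eps_optimal_primal \<phi> \<epsilon> (x kbar) \<and> eps_optimal_dual f A \<sigma> \<epsilon> (y kbar) (c kbar) \<and>
      bounded {(y k, c k) | k. enat k \<le> T}" if T: "T = enat kbar" for kbar
  proof -
    have z0: "z kbar = 0" using stop[of kbar] T by simp
    have "k \<le> kbar \<Longrightarrow> 0 \<le> c k" for k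
    proof (induction k)
      case (Suc k)
      then have "enat k < T" by (simp add: T)
      then have "0 \<le> (\<alpha> k + 1) * s k * S k"
        using \<alpha>[of k] s S(2) by (simp add: less_imp_le)
      with S(3)[OF \<open>enat k < T\<close>] Suc show ?case by simp
    qed (use run(1) in simp)
    then have "0 \<le> c kbar" by simp
    moreover have "(x kbar, 0) \<in> approx_minimizers f A \<sigma> (r kbar) (y kbar) (c kbar)"
      "r kbar \<le> \<epsilon>" using step(1,2)[of kbar] z0 T by auto
    moreover have "{(y k, c k) | k. enat k \<le> T} = (\<lambda>k. (y k, c k)) ` {..kbar}"
      by (auto simp: T)
    ultimately show ?thesis
      using approx_minimizer_zero_eps_optimal[of \<sigma> A f, OF \<sigma>0 A0 f0] by (simp add: finite_imp_bounded)
  qed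
  have run_on: "dual_unbounded \<and> limitin weak_topology z 0 sequentially \<and>
       (\<lambda>k. dual_fun f A \<sigma> (y k) (c k)) \<longlonglongrightarrow> primal_value \<phi> \<and>
       bounded (range x) \<and> (\<forall>p. weak_accumulation_point x p \<longrightarrow> p \<in> argmin_set \<phi>)"
    if T: "T = \<infinity>"
  proof -
    have lt: "enat k < T" "enat k \<le> T" for k by (simp_all add: T)
    note step = step[OF lt(2)] and S = S[OF lt(1)]
    have A_S: "norm (A (z k)) \<le> S k" for k using A_le[of "z k"] by (simp add: S(1))
    note growth = dual_iterates_growth[of y s "\<lambda>k. A (z k)" c \<alpha> S alpha_bar \<theta>,
        OF y[OF lt(1)] S(3) less_imp_le[OF s[OF lt(1)]] A_S assms(17,18) S(4) run(7)]
    have unbounded: "dual_unbounded"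
      using filterlim_at_top_unbounded_Pair[OF growth(2), of y]
      unfolding dual_unbounded_def by (simp add: T full_SetCompr_eq)
    have c_nonneg: "0 \<le> c k" for k using run(1) growth(1)[of k] by linarith
    define q where "q k = dual_fun f A \<sigma> (y k) (c k)" for k
    have q_le: "q k \<le> primal_value \<phi>" for k
      unfolding q_def using weak_duality[of \<sigma> A, OF \<sigma>0 A0, of f "y k" "c k"] by (simp add: \<phi>)
    \<comment> \<open>The primal value is finite: properness of \<phi> bounds it above, and the
      first dual value bounds it below.\<close>
    obtain u0 where "\<phi> u0 < \<infinity>" using assms(2) by (auto simp: proper_fun_def)
    then have "primal_value \<phi> < \<infinity>"
      unfolding primal_value_def by (meson INF_lower UNIV_I le_less_trans)
    moreover have "-\<infinity> < primal_value \<phi>"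
      using less_le_trans[OF run(2)] q_le[of 0] by (simp add: q_def)
    ultimately obtain m where m: "primal_value \<phi> = ereal m"
      by (cases "primal_value \<phi>") auto
    have m_le: "ereal m \<le> \<phi> u" for u
      unfolding m[symmetric] primal_value_def by (intro INF_lower) simp
    have lag: "lagrangian f A \<sigma> v d (x k, z k) = f (x k, z k) - ereal (A (z k) \<bullet> v) + ereal (d * S k)"
      for v d k by (simp add: lagrangian_def scale_ereal_def S(1))
    have min: "f (x k, z k) - ereal (A (z k) \<bullet> y k) + ereal (c k * S k) \<le> q k + ereal (r k)" for k
      using step(1)[of k] by (simp add: approx_minimizers_def lag q_def)
    define F where "F k = real_of_ereal (f (x k, z k))" for k
    have F: "f (x k, z k) = ereal (F k)" for k
    proof -
      have "q k + ereal (r k) \<le> ereal (m + r k)"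
        using add_right_mono[OF q_le[of k, unfolded m], of "ereal (r k)"] by simp
      with min[of k] have "f (x k, z k) - ereal (A (z k) \<bullet> y k) + ereal (c k * S k) \<le> ereal (m + r k)"
        by (rule order.trans)
      moreover have "-\<infinity> < f (x k, z k)" using proper_f by (simp add: proper_fun_def)
      ultimately show ?thesis unfolding F_def by (cases "f (x k, z k)") auto
    qed
    define Q where "Q k = real_of_ereal (q k)" for k
    \<comment> \<open>Near-minimality at a point with finite Lagrangian keeps \<open>q k\<close>
      above minus infinity; only the initial dual value was assumed to be so.\<close>
    have Q: "q k = ereal (Q k)" for k
      using min[of k] q_le[of k] unfolding Q_def m F by (cases "q k") auto
    have low: "Q 0 \<le> F k - A (z k) \<bullet> y 0 + c 0 * S k" for k
    proof -
      have "q 0 \<le> lagrangian f A \<sigma> (y 0) (c 0) (x k, z k)"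
        unfolding q_def dual_fun_def by (intro INF_lower) simp
      then show ?thesis by (simp add: lag F Q)
    qed
    have r: "r \<longlonglongrightarrow> 0"
      by (rule tendsto_sandwich[OF _ _ tendsto_const run(6)]) (simp_all add: step)
    have Q_le: "Q k \<le> m" for k using q_le[of k] by (simp add: Q m)
    have min': "F k - A (z k) \<bullet> y k + c k * S k \<le> Q k + r k" for k
      using min[of k] by (simp add: F Q)
    note est = penalty_estimates[of c "\<lambda>k. A (z k)" S F y Q r m,
        OF run(1) A_S min' Q_le low growth(3) r]
    define e where "e k = r k + norm (y 0) * S k" for k
    have e: "e \<longlonglongrightarrow> 0"
      unfolding e_def using tendsto_add[OF r tendsto_mult_left[OF est(1)]] by simp
    have F_le: "\<forall>\<^sub>F k in sequentially. F k \<le> Q k + e k" using est(2) by (simp add: e_def)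
    have "(\<lambda>k. \<sigma> (z k)) \<longlonglongrightarrow> 0"
      using tendsto_ereal[OF est(1)] by (simp add: S(1) zero_ereal_def)
    moreover have "conditionally_coercive \<sigma>"
      using assms(19) coercive_imp_conditionally_coercive by blast
    ultimately have z: "limitin weak_topology z 0 sequentially"
      by (intro minimizing_sequence_weak_limit[OF lsc_\<sigma> \<sigma>0 argmin_\<sigma>])
    have F_less: "\<forall>\<^sub>F k in sequentially. F k < t" if "m < t" for t
    proof -
      have "\<forall>\<^sub>F k in sequentially. e k < t - m" using that by (intro order_tendstoD(2)[OF e]) simp
      with F_le show ?thesis by eventually_elim (use Q_le in \<open>smt (verit)\<close>)
    qed
    \<comment> \<open>Any level above \<open>m\<close> would do here, since \<open>F k\<close>
      eventually falls below each of them.\<close>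
    obtain U B where U: "openin weak_topology U" "0 \<in> U" and B: "weakly_compact B"
      and UB: "\<And>w. w \<in> U \<Longrightarrow> {u. f (u, w) \<le> ereal (m + 1)} \<subseteq> B"
      using level_f unfolding weakly_level_compact_def by meson
    have "\<forall>\<^sub>F k in sequentially. z k \<in> U" using z U by (auto simp: limitin_def)
    moreover have "\<forall>\<^sub>F k in sequentially. F k < m + 1" by (intro F_less) simp
    ultimately have x_B: "\<forall>\<^sub>F k in sequentially. x k \<in> B"
    proof eventually_elim
      case (elim k)
      then have "f (x k, z k) \<le> ereal (m + 1)" by (simp add: F)
      with UB[of "z k"] elim show ?case by blast
    qed
    then obtain N where N: "\<And>k. N \<le> k \<Longrightarrow> x k \<in> B" by (auto simp: eventually_sequentially)
    have "range x \<subseteq> x ` {..N} \<union> B"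
    proof
      fix u assume "u \<in> range x"
      then obtain k where "u = x k" by blast
      then show "u \<in> x ` {..N} \<union> B" using N[of k] by (cases "k \<le> N") auto
    qed
    then have x_bounded: "bounded (range x)"
      by (rule bounded_subset[rotated]) (simp add: finite_imp_bounded weakly_compact_imp_bounded[OF B])
    \<comment> \<open>On the slice \<open>z = 0\<close> the function \<open>f\<close> is \<phi>,
      hence at least \<open>m\<close>; the tube argument carries each smaller bound over to
      \<open>(x k, z k)\<close>.\<close>
    have F_greater: "\<forall>\<^sub>F k in sequentially. t < F k" if "t < m" for t
    proof -
      have "ereal t < f (u, 0)" for u
        unfolding f0 using that by (intro less_le_trans[OF _ m_le]) simp
      from w_lsc_eventually_greater[OF lsc_f B this z x_B] show ?thesis by (simp add: F)
    qed
    have "F \<longlonglongrightarrow> m" by (rule order_tendstoI[OF F_greater F_less])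
    from tendsto_diff[OF this e] have "(\<lambda>k. F k - e k) \<longlonglongrightarrow> m" by simp
    \<comment> \<open>The dual values are squeezed between \<open>F k - e k\<close> and the primal
      value \<open>m\<close>.\<close>
    then have "Q \<longlonglongrightarrow> m"
    proof (rule tendsto_sandwich[rotated 2, OF _ tendsto_const])
      show "\<forall>\<^sub>F k in sequentially. F k - e k \<le> Q k" using F_le by eventually_elim simp
    qed (simp add: Q_le)
    then have q: "q \<longlonglongrightarrow> primal_value \<phi>" using tendsto_ereal[of Q m sequentially] by (simp add: Q[abs_def] m)
    have "p \<in> argmin_set \<phi>" if p: "weak_accumulation_point x p" for p
    proof -
      have "f (p, 0) \<le> ereal m"
      proof (rule w_lsc_accumulation_point_le[OF lsc_f z p])
        fix t assume "ereal m < ereal t"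
        then have "\<forall>\<^sub>F k in sequentially. F k < t" by (intro F_less) simp
        then show "\<forall>\<^sub>F k in sequentially. f (x k, z k) \<le> ereal t"
          by eventually_elim (simp add: F)
      qed
      from order.trans[OF this m_le] show ?thesis by (simp add: argmin_set_def f0)
    qed
    with unbounded z q x_bounded show ?thesis by (simp add: q_def[abs_def])
  qed
  \<comment> \<open>Exclusivity comes from \<open>T\<close> alone: a finite \<open>T\<close> leaves
    finitely many dual iterates, an infinite one makes them unbounded.\<close>
  show ?thesis
  proof (cases T)
    case (enat kbar)
    then show ?thesis using stopped by (auto simp: stops_def dual_unbounded_def)
  next
    case infinity
    then show ?thesis using run_on by (auto simp: stops_def)
  qed
qed

end
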